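(* Let $H$ be a separable complex Hilbert space and let $A\colon H\supset \mathrm{dom}(A)\to H$ be a linear operator satisfying (OP1)–(OP5) (stated in the context), and fix for every $Y>0$ a function $\phi_Y\in\mathscr{F}$ as in the context. The following are equivalent. (i) The Riemann Hypothesis holds for $A$, i.e. $\mathrm{Re}(s)=\tfrac12$ for all $s\in\sigma(A)$. (ii) There exist: an $\mathbb{R}$-linear space $V$; a symmetric bilinear form $\beta\colon V\times V\to\mathbb{R}$; nonzero vectors $v_{01},v_{10},h_a\in V$; an $\mathbb{R}$-subalgebra $\mathrm{dom}(\widetilde v_\delta)\subset\mathscr{F}$ containing all $\phi_Y$ ($Y>0$); a map $\widetilde v_\delta\colon \mathrm{dom}(\widetilde v_\delta)\to V$; and an $\mathbb{R}$-algebra homomorphism $\widetilde\Phi\colon \mathrm{dom}(\widetilde v_\delta)\to \mathrm{End}_{\mathbb{R}}(V)$. Moreover, writing $v_\delta=v_\delta(Y):=\widetilde v_\delta(\phi_Y)$, $\Phi=\Phi(Y):=\widetilde\Phi(\phi_Y)$ and $q=q(Y):=\phi_Y(1)$, these data satisfy the following axioms. (INT1) For every $Y>0$ and all integers $n\ge 0$: (a) $\beta(v_{01},v_{01})=0$; (b) $\beta(v_{10},v_{10})=0$; (c) $\beta(v_{01},v_{10})=1$; (d) $\beta(\Phi^n v_\delta,v_{01})=1$; (e) $\beta(\Phi^n v_\delta,v_{10})=O(q^n)$; (f) $\beta(\Phi^n v_\delta,\Phi^n v_\delta)=O(q^n)$; (g) $\beta(x,y)=\beta(y,x)\in\mathbb{R}$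 for all $x,y\in V$. Here $O(q^n)$ is understood as $n\to\infty$ with $Y$, and hence $q=q(Y)$, fixed. (INT2) (Hodge property) For $x\in V$, if $\beta(x,h_a)=0$ then $\beta(x,x)\le 0$. (INT3) (Lefschetz type formula) For every $\phi\in\mathrm{dom}(\widetilde v_\delta)$ and every integer $n\ge0$, $$\mathrm{tr}(\phi(A)^n)=\langle \widetilde\Phi(\phi)^n\widetilde v_\delta(\phi),\widetilde v_\delta(\phi)\rangle_V,$$ where for $x,y\in V$ one sets $\langle x,y\rangle_V:=\beta(x,v_{01})\beta(y,v_{10})+\beta(x,v_{10})\beta(y,v_{01})-\beta(x,y)$.
   Context: Let $H$ be a separable complex Hilbert space and $A\colon H\supset\mathrm{dom}(A)\to H$ a linear operator, with spectrum $\sigma(A)$ and point spectrum (set of eigenvalues) $\sigma_p(A)$. Riesz projections: suppose $W\subset\sigma(A)$ is bounded, and there is a bounded domain $\Delta\subset\mathbb{C}$ with $\overline W\subset\Delta^\circ$ and $\overline\Delta\cap(\sigma(A)\setminus W)=\emptyset$. Then $P_W:=\frac{1}{2\pi i}\oint_{\partial\Delta}(s-A)^{-1}\,ds$. For $s_\alpha\in\sigma_p(A)$: - the algebraic multiplicity is $\mathrm{mult}(s_\alpha):=\dim\mathrm{Image}(P_{\{s_\alpha\}})$; - the Riesz index $\nu(s_\alpha)$ is the smallest positive integer $\nu$ with $\mathrm{Ker}((s_\alpha-A)^\nu)=\mathrm{Image}(P_{\{s_\alpha\}})$. Conditions on $A$: (OP1) $A$ is closed. (OP2) $\sigma(A)=\sigma_p(A)$,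 and $\sigma(A)$ accumulates at most at infinity. (OP3) (a) $\mathrm{Image}(P_{\{s_\alpha\}})$ is finite dimensional for every $s_\alpha\in\sigma_p(A)$; (b) $\nu(s_\alpha)=1$ for every $s_\alpha\in\sigma_p(A)$. (OP4) $\sigma(A)\subset\Omega_\infty:=\{s\in\mathbb{C}:0<\mathrm{Re}(s)<1\}$. (OP5) (a) There is $s_\alpha\in\sigma(A)$ with $\mathrm{Re}(s_\alpha)<\frac12$ if and only if there is $s_\beta\in\sigma(A)$ with $\mathrm{Re}(s_\beta)>\frac12$; (b) if $s\in\sigma(A)$ then $\overline s\in\sigma(A)$, with $\mathrm{mult}(\overline s)=\mathrm{mult}(s)$. Cut-offs: for $Y>0$ let $\sigma_Y(A):=\{s\in\sigma(A):|\mathrm{Im}(s)|\le Y\}$. Let $\Omega_Y:=\{s:0<\mathrm{Re}(s)<1,\ |\mathrm{Im}(s)|<Y+\epsilon_Y\}$, where $\epsilon_Y>0$ is chosen so that $\overline{\Omega_Y}\cap(\sigma(A)\setminus\sigma_Y(A))=\emptyset$. The algebra $\mathscr{F}$ consists of all functions $\phi$ that are holomorphic on some open set containing $\overline{\Omega_\infty}$ and satisfy $\phi(\overline s)=\overline{\phi(s)}$ for $s\in\sigma(A)\cup\{0,1\}$; it is an $\mathbb{R}$-algebra. Functional calculus: for $\phi\in\mathscr{F}$, $$\phi(A)x:=\lim_{Y\to\infty}\frac{1}{2\pi i}\Big(\oint_{\partial\Omega_Y}\phi(s)(s-A)^{-1}ds\Big)x,$$ defined for those $x$ for which the limit exists in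 $H$. Equivalently, $\phi(A)=\sum_{s\in\sigma(A)}\phi(s)P_{\{s\}}$. Trace: $\mathrm{tr}(\phi(A)^n):=\sum_{s\in\sigma(A)}\mathrm{mult}(s)\phi(s)^n$, whenever this sum is finite. For each $Y>0$, $\phi_Y\in\mathscr{F}$ is a fixed function satisfying: (i) $\phi_Y(0)=1$; (ii) $\phi_Y(1)\in(0,1)\cup(1,\infty)$; (iii) $\phi_Y(s)=\phi_Y(1)^s$ for $s\in\sigma_Y(A)$; (iv) $\phi_Y(s)=0$ for $s\in\sigma(A)\setminus\sigma_Y(A)$. Such functions exist by Weierstrass factorization.
   Formalization: In (INT3) the formula at n=0 is required only when the trace, the total multiplicity of the spectrum, is finite (for infinite spectrum it diverges and the literal axiom can never hold); subalgebras need not contain the constant 1, and homomorphisms preserve 1 only if it is present. *)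

theory Defs
  imports "HOL-Complex_Analysis.Complex_Analysis" "HOL-Analysis.Finite_Function_Topology" "HOL-Library.Landau_Symbols"
begin

section \<open>Complex Hilbert spaces\<close>

class complex_hilbert_space = banach +
  fixes scaleC :: "complex \<Rightarrow> 'a \<Rightarrow> 'a" (infixr "*\<^sub>C" 75)
    and cinner :: "'a \<Rightarrow> 'a \<Rightarrow> complex"
  assumes scaleC_add_right: "c *\<^sub>C (x + y) = c *\<^sub>C x + c *\<^sub>C y"
    and scaleC_add_left: "(c + d) *\<^sub>C x = c *\<^sub>C x + d *\<^sub>C x"
    and scaleC_scaleC: "c *\<^sub>C d *\<^sub>C x = (c * d) *\<^sub>C x"
    and scaleR_scaleC: "r *\<^sub>R x = complex_of_real r *\<^sub>C x"
    and cinner_commute: "cinner x y = cnj (cinner y x)"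
    and cinner_add_right: "cinner x (y + z) = cinner x y + cinner x z"
    and cinner_scaleC_right: "cinner x (c *\<^sub>C y) = c * cinner x y"
    and cinner_norm: "cinner x x = complex_of_real ((norm x)\<^sup>2)"

interpretation complex_vs: vector_space "scaleC :: complex \<Rightarrow> 'h \<Rightarrow> 'h::complex_hilbert_space"
proof
  fix x :: 'h
  show "1 *\<^sub>C x = x"
    using scaleR_scaleC[of 1 x] by simp
qed (simp_all add: scaleC_add_right scaleC_add_left scaleC_scaleC)


section \<open>Unbounded operators and their spectrum\<close>

text \<open>An operator is given by its domain \<^term>\<open>D\<close> and a function \<^term>\<open>A\<close> whose values outside
  \<^term>\<open>D\<close> are never used.\<close>

definition linear_operator :: "'h::complex_hilbert_space set \<Rightarrow> ('h \<Rightarrow> 'h) \<Rightarrow> bool" where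
  "linear_operator D A \<longleftrightarrow> complex_vs.subspace D \<and>
     (\<forall>x\<in>D. \<forall>y\<in>D. A (x + y) = A x + A y) \<and> (\<forall>c. \<forall>x\<in>D. A (c *\<^sub>C x) = c *\<^sub>C A x)"

definition closed_operator :: "'h::complex_hilbert_space set \<Rightarrow> ('h \<Rightarrow> 'h) \<Rightarrow> bool" where
  "closed_operator D A \<longleftrightarrow> closed ((\<lambda>x. (x, A x)) ` D)"

definition shifted :: "('h::complex_hilbert_space \<Rightarrow> 'h) \<Rightarrow> complex \<Rightarrow> 'h \<Rightarrow> 'h" where
  "shifted A s x = s *\<^sub>C x - A x"

definition resolvent :: "'h::complex_hilbert_space set \<Rightarrow> ('h \<Rightarrow> 'h) \<Rightarrow> complex \<Rightarrow> 'h \<Rightarrow> 'h" where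
  "resolvent D A s = inv_into D (shifted A s)"

definition spectrum :: "'h::complex_hilbert_space set \<Rightarrow> ('h \<Rightarrow> 'h) \<Rightarrow> complex set" where
  "spectrum D A = {s. \<not> (bij_betw (shifted A s) D UNIV \<and> bounded_linear (resolvent D A s))}"

definition point_spectrum :: "'h::complex_hilbert_space set \<Rightarrow> ('h \<Rightarrow> 'h) \<Rightarrow> complex set" where
  "point_spectrum D A = {s. \<exists>x\<in>D. x \<noteq> 0 \<and> A x = s *\<^sub>C x}"

definition kernel_power ::
  "'h::complex_hilbert_space set \<Rightarrow> ('h \<Rightarrow> 'h) \<Rightarrow> complex \<Rightarrow> nat \<Rightarrow> 'h set" where
  "kernel_power D A s n =
     {x. (\<forall>k<n. (shifted A s ^^ k) x \<in> D) \<and> (shifted A s ^^ n) x = 0}"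


section \<open>Riesz projections\<close>

text \<open>The positively oriented boundary of a bounded domain, which may consist of several closed
  curves, is a list of disjoint piecewise continuously differentiable Jordan curves.\<close>

definition oriented_boundary :: "complex set \<Rightarrow> (real \<Rightarrow> complex) list \<Rightarrow> bool" where
  "oriented_boundary \<Delta> \<Gamma> \<longleftrightarrow>
     (\<forall>\<gamma>\<in>set \<Gamma>. valid_path \<gamma> \<and> simple_path \<gamma> \<and> pathfinish \<gamma> = pathstart \<gamma>) \<and>
     (\<forall>i<length \<Gamma>. \<forall>j<i. path_image (\<Gamma> ! i) \<inter> path_image (\<Gamma> ! j) = {}) \<and>
     frontier \<Delta> = (\<Union>\<gamma>\<in>set \<Gamma>. path_image \<gamma>) \<and>
     (\<forall>z\<in>\<Delta>. (\<Sum>\<gamma>\<leftarrow>\<Gamma>. winding_number \<gamma> z) = 1) \<and>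
     (\<forall>z. z \<notin> closure \<Delta> \<longrightarrow> (\<Sum>\<gamma>\<leftarrow>\<Gamma>. winding_number \<gamma> z) = 0)"

text \<open>Contour integrals of operator-valued functions, taken in the operator norm.\<close>

definition operator_contour_integral ::
  "(real \<Rightarrow> complex) \<Rightarrow> (complex \<Rightarrow> 'h \<Rightarrow> 'h) \<Rightarrow> 'h::complex_hilbert_space \<Rightarrow>\<^sub>L 'h" where
  "operator_contour_integral \<gamma> F =
     integral {0..1} (\<lambda>t. Blinfun (\<lambda>x. vector_derivative \<gamma> (at t within {0..1}) *\<^sub>C F (\<gamma> t) x))"

definition riesz_domain ::
  "'h::complex_hilbert_space set \<Rightarrow> ('h \<Rightarrow> 'h) \<Rightarrow> complex set \<Rightarrow> complex set \<Rightarrow> bool" where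
  "riesz_domain D A W \<Delta> \<longleftrightarrow> bounded \<Delta> \<and> open \<Delta> \<and> connected \<Delta> \<and>
     closure W \<subseteq> interior \<Delta> \<and> closure \<Delta> \<inter> (spectrum D A - W) = {}"

text \<open>By Cauchy's theorem the integral does not depend on the chosen domain and boundary curves.\<close>

definition riesz_projection ::
  "'h::complex_hilbert_space set \<Rightarrow> ('h \<Rightarrow> 'h) \<Rightarrow> complex set \<Rightarrow> 'h \<Rightarrow> 'h" where
  "riesz_projection D A W =
     (SOME P. \<exists>\<Delta> \<Gamma>. riesz_domain D A W \<Delta> \<and> oriented_boundary \<Delta> \<Gamma> \<and>
        P = (\<lambda>x. (1 / (2 * of_real pi * \<i>)) *\<^sub>C
               blinfun_apply (\<Sum>\<gamma>\<leftarrow>\<Gamma>. operator_contour_integral \<gamma> (resolvent D A)) x))"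

definition alg_mult :: "'h::complex_hilbert_space set \<Rightarrow> ('h \<Rightarrow> 'h) \<Rightarrow> complex \<Rightarrow> nat" where
  "alg_mult D A s = complex_vs.dim (range (riesz_projection D A {s}))"

text \<open>The value is infinite if no exponent has the required property.\<close>

definition riesz_index :: "'h::complex_hilbert_space set \<Rightarrow> ('h \<Rightarrow> 'h) \<Rightarrow> complex \<Rightarrow> enat" where
  "riesz_index D A s =
     Inf (enat ` {\<nu>. 0 < \<nu> \<and> kernel_power D A s \<nu> = range (riesz_projection D A {s})})"


section \<open>Conditions on the operator\<close>

definition OP1 :: "'h::complex_hilbert_space set \<Rightarrow> ('h \<Rightarrow> 'h) \<Rightarrow> bool" where
  "OP1 D A \<longleftrightarrow> closed_operator D A"

definition OP2 :: "'h::complex_hilbert_space set \<Rightarrow> ('h \<Rightarrow> 'h) \<Rightarrow> bool" where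
  "OP2 D A \<longleftrightarrow> spectrum D A = point_spectrum D A \<and> (\<forall>z. \<not> z islimpt spectrum D A)"

definition OP3 :: "'h::complex_hilbert_space set \<Rightarrow> ('h \<Rightarrow> 'h) \<Rightarrow> bool" where
  "OP3 D A \<longleftrightarrow>
     (\<forall>s\<in>point_spectrum D A.
        \<exists>B. finite B \<and> complex_vs.span B = range (riesz_projection D A {s})) \<and>
     (\<forall>s\<in>point_spectrum D A. riesz_index D A s = 1)"

definition Omega_infinity :: "complex set" where
  "Omega_infinity = {s. 0 < Re s \<and> Re s < 1}"

definition OP4 :: "'h::complex_hilbert_space set \<Rightarrow> ('h \<Rightarrow> 'h) \<Rightarrow> bool" where
  "OP4 D A \<longleftrightarrow> spectrum D A \<subseteq> Omega_infinity"

definition OP5 :: "'h::complex_hilbert_space set \<Rightarrow> ('h \<Rightarrow> 'h) \<Rightarrow> bool" where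
  "OP5 D A \<longleftrightarrow>
     ((\<exists>s\<in>spectrum D A. Re s < 1 / 2) \<longleftrightarrow> (\<exists>s\<in>spectrum D A. Re s > 1 / 2)) \<and>
     (\<forall>s\<in>spectrum D A. cnj s \<in> spectrum D A \<and> alg_mult D A (cnj s) = alg_mult D A s)"

definition riemann_hypothesis :: "'h::complex_hilbert_space set \<Rightarrow> ('h \<Rightarrow> 'h) \<Rightarrow> bool" where
  "riemann_hypothesis D A \<longleftrightarrow> (\<forall>s\<in>spectrum D A. Re s = 1 / 2)"


section \<open>The function algebra, the cut-off functions and the trace\<close>

text \<open>Elements of the algebra are total functions with pointwise operations; only their values
  near the closed strip are constrained.\<close>

definition function_algebra ::
  "'h::complex_hilbert_space set \<Rightarrow> ('h \<Rightarrow> 'h) \<Rightarrow> (complex \<Rightarrow> complex) set" where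
  "function_algebra D A =
     {\<phi>. (\<exists>U. open U \<and> closure Omega_infinity \<subseteq> U \<and> \<phi> holomorphic_on U) \<and>
         (\<forall>s\<in>spectrum D A \<union> {0, 1}. \<phi> (cnj s) = cnj (\<phi> s))}"

definition spectrum_cutoff ::
  "'h::complex_hilbert_space set \<Rightarrow> ('h \<Rightarrow> 'h) \<Rightarrow> real \<Rightarrow> complex set" where
  "spectrum_cutoff D A Y = {s\<in>spectrum D A. \<bar>Im s\<bar> \<le> Y}"

definition cutoff_function ::
  "'h::complex_hilbert_space set \<Rightarrow> ('h \<Rightarrow> 'h) \<Rightarrow> real \<Rightarrow> (complex \<Rightarrow> complex) \<Rightarrow> bool" where
  "cutoff_function D A Y \<phi> \<longleftrightarrow>
     \<phi> \<in> function_algebra D A \<and>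
     \<phi> 0 = 1 \<and>
     \<phi> 1 \<in> complex_of_real ` ({0<..<1} \<union> {1<..}) \<and>
     (\<forall>s\<in>spectrum_cutoff D A Y. \<phi> s = \<phi> 1 powr s) \<and>
     (\<forall>s\<in>spectrum D A - spectrum_cutoff D A Y. \<phi> s = 0)"

text \<open>\<open>trace_power D A \<phi> n\<close> is the trace of the \<open>n\<close>-th power of \<open>\<phi>(A)\<close>;
  it is meaningful only if \<open>trace_power_finite D A \<phi> n\<close> holds.\<close>

definition trace_power_finite ::
  "'h::complex_hilbert_space set \<Rightarrow> ('h \<Rightarrow> 'h) \<Rightarrow> (complex \<Rightarrow> complex) \<Rightarrow> nat \<Rightarrow> bool" where
  "trace_power_finite D A \<phi> n \<longleftrightarrow>
     (\<lambda>s. of_nat (alg_mult D A s) * \<phi> s ^ n) summable_on spectrum D A"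

definition trace_power ::
  "'h::complex_hilbert_space set \<Rightarrow> ('h \<Rightarrow> 'h) \<Rightarrow> (complex \<Rightarrow> complex) \<Rightarrow> nat \<Rightarrow> complex" where
  "trace_power D A \<phi> n = (\<Sum>\<^sub>\<infinity>s\<in>spectrum D A. of_nat (alg_mult D A s) * \<phi> s ^ n)"


section \<open>Intersection theories\<close>

text \<open>Subalgebras need not contain the constant 1, because the trace of the identity is infinite if
  the spectrum is; homomorphisms preserve 1 if it is present.\<close>

definition real_subalgebra :: "(complex \<Rightarrow> complex) set \<Rightarrow> (complex \<Rightarrow> complex) set \<Rightarrow> bool" where
  "real_subalgebra S F \<longleftrightarrow> S \<subseteq> F \<and> (\<lambda>s. 0) \<in> S \<and>
     (\<forall>\<phi>\<in>S. \<forall>\<psi>\<in>S. (\<lambda>s. \<phi> s + \<psi> s) \<in> S \<and> (\<lambda>s. \<phi> s * \<psi> s) \<in> S) \<and>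
     (\<forall>r::real. \<forall>\<phi>\<in>S. (\<lambda>s. of_real r * \<phi> s) \<in> S)"

definition real_algebra_hom ::
  "(complex \<Rightarrow> complex) set \<Rightarrow> ((complex \<Rightarrow> complex) \<Rightarrow> 'v::real_vector \<Rightarrow> 'v) \<Rightarrow> bool" where
  "real_algebra_hom S \<Phi> \<longleftrightarrow>
     (\<forall>\<phi>\<in>S. linear (\<Phi> \<phi>)) \<and>
     (\<forall>\<phi>\<in>S. \<forall>\<psi>\<in>S. \<Phi> (\<lambda>s. \<phi> s + \<psi> s) = (\<lambda>x. \<Phi> \<phi> x + \<Phi> \<psi> x)) \<and>
     (\<forall>\<phi>\<in>S. \<forall>\<psi>\<in>S. \<Phi> (\<lambda>s. \<phi> s * \<psi> s) = \<Phi> \<phi> \<circ> \<Phi> \<psi>) \<and>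
     (\<forall>r::real. \<forall>\<phi>\<in>S. \<Phi> (\<lambda>s. of_real r * \<phi> s) = (\<lambda>x. r *\<^sub>R \<Phi> \<phi> x)) \<and>
     ((\<lambda>s. 1) \<in> S \<longrightarrow> \<Phi> (\<lambda>s. 1) = id)"

definition INT1 ::
  "('v::real_vector \<Rightarrow> 'v \<Rightarrow> real) \<Rightarrow> 'v \<Rightarrow> 'v \<Rightarrow> ((complex \<Rightarrow> complex) \<Rightarrow> 'v) \<Rightarrow>
   ((complex \<Rightarrow> complex) \<Rightarrow> 'v \<Rightarrow> 'v) \<Rightarrow> (real \<Rightarrow> complex \<Rightarrow> complex) \<Rightarrow> bool" where
  "INT1 \<beta> v01 v10 v\<delta> \<Phi> \<phi> \<longleftrightarrow>
     \<beta> v01 v01 = 0 \<and> \<beta> v10 v10 = 0 \<and> \<beta> v01 v10 = 1 \<and>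
     (\<forall>Y>0. let v = v\<delta> (\<phi> Y); T = \<Phi> (\<phi> Y); q = Re (\<phi> Y 1) in
        (\<forall>n. \<beta> ((T ^^ n) v) v01 = 1) \<and>
        (\<lambda>n. \<beta> ((T ^^ n) v) v10) \<in> O[sequentially](\<lambda>n. q ^ n) \<and>
        (\<lambda>n. \<beta> ((T ^^ n) v) ((T ^^ n) v)) \<in> O[sequentially](\<lambda>n. q ^ n)) \<and>
     (\<forall>x y. \<beta> x y = \<beta> y x)"

definition INT2 :: "('v::real_vector \<Rightarrow> 'v \<Rightarrow> real) \<Rightarrow> 'v \<Rightarrow> bool" where
  "INT2 \<beta> ha \<longleftrightarrow> (\<forall>x. \<beta> x ha = 0 \<longrightarrow> \<beta> x x \<le> 0)"

definition primitive_form :: "('v::real_vector \<Rightarrow> 'v \<Rightarrow> real) \<Rightarrow> 'v \<Rightarrow> 'v \<Rightarrow> 'v \<Rightarrow> 'v \<Rightarrow> real" where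
  "primitive_form \<beta> v01 v10 x y = \<beta> x v01 * \<beta> y v10 + \<beta> x v10 * \<beta> y v01 - \<beta> x y"

text \<open>The traces with \<open>n \<ge> 1\<close> are required to be finite. For \<open>n = 0\<close> the sum is the total
  multiplicity of the spectrum, whatever \<open>\<phi>\<close> is; it diverges for infinite spectrum, and then
  the formula makes no claim.\<close>

definition INT3 ::
  "'h::complex_hilbert_space set \<Rightarrow> ('h \<Rightarrow> 'h) \<Rightarrow> ('v::real_vector \<Rightarrow> 'v \<Rightarrow> real) \<Rightarrow> 'v \<Rightarrow> 'v \<Rightarrow>
   (complex \<Rightarrow> complex) set \<Rightarrow> ((complex \<Rightarrow> complex) \<Rightarrow> 'v) \<Rightarrow>
   ((complex \<Rightarrow> complex) \<Rightarrow> 'v \<Rightarrow> 'v) \<Rightarrow> bool" where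
  "INT3 D A \<beta> v01 v10 S v\<delta> \<Phi> \<longleftrightarrow>
     (\<forall>\<phi>\<in>S.
        (\<forall>n\<ge>1. trace_power_finite D A \<phi> n) \<and>
        (\<forall>n. trace_power_finite D A \<phi> n \<longrightarrow>
           trace_power D A \<phi> n =
             complex_of_real (primitive_form \<beta> v01 v10 ((\<Phi> \<phi> ^^ n) (v\<delta> \<phi>)) (v\<delta> \<phi>))))"

text \<open>The real vector space is the type \<open>'v\<close>. Types cannot be quantified inside a formula, so
  existence of some space is expressed by a concrete type where it is concluded, and by a
  type variable where it is assumed.\<close>

definition admits_intersection_theory ::
  "'v::real_vector itself \<Rightarrow> 'h::complex_hilbert_space set \<Rightarrow> ('h \<Rightarrow> 'h) \<Rightarrow>
   (real \<Rightarrow> complex \<Rightarrow> complex) \<Rightarrow> bool" where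
  "admits_intersection_theory (_ :: 'v itself) D A \<phi> \<longleftrightarrow>
     (\<exists>(\<beta> :: 'v \<Rightarrow> 'v \<Rightarrow> real) v01 v10 ha S v\<delta> \<Phi>.
        bilinear \<beta> \<and> (\<forall>x y. \<beta> x y = \<beta> y x) \<and>
        v01 \<noteq> 0 \<and> v10 \<noteq> 0 \<and> ha \<noteq> 0 \<and>
        real_subalgebra S (function_algebra D A) \<and> (\<forall>Y>0. \<phi> Y \<in> S) \<and>
        real_algebra_hom S \<Phi> \<and>
        INT1 \<beta> v01 v10 v\<delta> \<Phi> \<phi> \<and> INT2 \<beta> ha \<and> INT3 D A \<beta> v01 v10 S v\<delta> \<Phi>)"

end

theory Submission
  imports Defs
begin

text \<open>
  If an intersection theory exists, the Hodge property makes the primitive form positive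
  semidefinite, so Cauchy--Schwarz and the Lefschetz formula bound the traces:
  the sum of \<open>mult(s) q^(n s)\<close> over \<open>\<sigma>\<^sub>Y(A)\<close> is \<open>O(q^(n/2))\<close>. As the coefficients are positive, no
  single \<open>\<bar>q^s\<bar>\<close> exceeds \<open>q^(1/2)\<close>, which places \<open>\<sigma>\<^sub>Y(A)\<close> on one side of the critical line, and
  (OP5)(a) rules out any point off the line. Conversely, under the Riemann Hypothesis, finitely
  supported functions carry the orthogonal sum of a hyperbolic plane (coordinates \<open>0\<close> and \<open>1\<close>) and
  a negative semidefinite form on the spectrum weighted by multiplicities; \<open>\<Phi>(\<phi>)\<close> multiplies
  by \<open>\<phi>\<close> pointwise, and \<open>v\<^sub>\<delta>(\<phi>)\<close> is an indicator function.
\<close>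

section \<open>Growth of power sums\<close>

text \<open>If \<open>x\<close> exceeded \<open>r\<close>, the powers \<open>(x / r) ^ n\<close>
  would tend to infinity and pass the constant \<open>K / a\<close>.\<close>

lemma geometric_le_imp_base_le:
  fixes a r K :: real
  assumes "a > 0" "r > 0" "\<forall>\<^sub>F n in sequentially. a * x ^ n \<le> K * r ^ n"
  shows "x \<le> r"
proof (rule ccontr)
  assume "\<not> x \<le> r"
  then have "1 < x / r" using assms(2) by simp
  then have "filterlim (\<lambda>n. (x / r) ^ n) at_top sequentially"
    using assms(2)
    by (intro filterlim_at_infinity_imp_filterlim_at_top filterlim_realpow_sequentially_gt1)
      (auto intro!: always_eventually)
  then have "\<forall>\<^sub>F n in sequentially. (x / r) ^ n > K / a"
    by (simp add: filterlim_at_top_dense)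
  with assms(3) have "\<forall>\<^sub>F n in sequentially. False"
  proof eventually_elim
    case (elim n)
    then have "K * r ^ n < a * x ^ n"
      using assms(1,2) by (simp add: power_divide field_simps)
    with elim show ?case by simp
  qed
  then show False by simp
qed

text \<open>Convolving the sequence with the coefficients of a polynomial that vanishes at all nodes
  except \<open>w\<close> isolates the term of \<open>w\<close>.\<close>

lemma power_sum_bounded_imp_node_le:
  fixes c :: "complex \<Rightarrow> complex"
  assumes "finite Z" "w \<in> Z" "c w \<noteq> 0" "r > 0"
    and bound: "\<forall>\<^sub>F n in sequentially. norm (\<Sum>z\<in>Z. c z * z ^ n) \<le> C * r ^ n"
  shows "norm w \<le> r"
proof -
  define p where "p = (\<Prod>z\<in>Z - {w}. [:- z, 1:])"
  have p_w: "poly p w \<noteq> 0"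
    using assms(1) by (auto simp: p_def poly_prod)
  have p_0: "poly p z = 0" if "z \<in> Z" "z \<noteq> w" for z
    using that assms(1) by (auto simp: p_def poly_prod)
  have conv: "(\<Sum>i\<le>degree p. coeff p i * (\<Sum>z\<in>Z. c z * z ^ (n + i))) = c w * poly p w * w ^ n" for n
  proof -
    have "(\<Sum>i\<le>degree p. coeff p i * (\<Sum>z\<in>Z. c z * z ^ (n + i))) =
        (\<Sum>z\<in>Z. \<Sum>i\<le>degree p. coeff p i * (c z * z ^ (n + i)))"
      by (subst sum.swap) (simp add: sum_distrib_left)
    also have "\<dots> = (\<Sum>z\<in>Z. c z * poly p z * z ^ n)"
      by (intro sum.cong refl)
        (simp add: poly_altdef sum_distrib_left sum_distrib_right power_add mult_ac)
    also have "\<dots> = (\<Sum>z\<in>{w}. c z * poly p z * z ^ n)"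
      using assms(1,2) p_0 by (intro sum.mono_neutral_right) auto
    finally show ?thesis by simp
  qed
  obtain N where N: "norm (\<Sum>z\<in>Z. c z * z ^ n) \<le> C * r ^ n" if "n \<ge> N" for n
    using bound by (auto simp: eventually_sequentially)
  \<comment> \<open>Shifting the exponent by \<open>i\<close> costs only the factor
    \<open>r ^ i\<close>, so the bound survives with a constant independent of
    \<open>n\<close>.\<close>
  have "norm (c w * poly p w) * norm w ^ n \<le> (\<Sum>i\<le>degree p. norm (coeff p i) * C * r ^ i) * r ^ n"
    if "n \<ge> N" for n
  proof -
    have "norm (c w * poly p w) * norm w ^ n =
        norm (\<Sum>i\<le>degree p. coeff p i * (\<Sum>z\<in>Z. c z * z ^ (n + i)))"
      by (simp add: conv norm_mult norm_power)
    also have "\<dots> \<le> (\<Sum>i\<le>degree p. norm (coeff p i) * (C * r ^ (n + i)))"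
      using that N by (intro sum_norm_le) (auto simp: norm_mult intro!: mult_left_mono)
    also have "\<dots> = (\<Sum>i\<le>degree p. norm (coeff p i) * C * r ^ i) * r ^ n"
      unfolding sum_distrib_right by (simp add: power_add mult_ac)
    finally show ?thesis .
  qed
  then show ?thesis
    using assms(3,4) p_w
    by (intro geometric_le_imp_base_le[of "norm (c w * poly p w)"])
      (auto simp: eventually_sequentially)
qed

text \<open>The nodes \<open>f s\<close> may coincide; positivity of the weights prevents cancellation.\<close>

lemma weighted_power_sum_bounded_imp_node_le:
  fixes f :: "'a \<Rightarrow> complex" and m :: "'a \<Rightarrow> nat"
  assumes fin: "finite I" and "i \<in> I" and pos: "\<And>s. s \<in> I \<Longrightarrow> m s > 0" and "r > 0"
    and bound: "\<forall>\<^sub>F n in sequentially. norm (\<Sum>s\<in>I. of_nat (m s) * f s ^ n) \<le> C * r ^ n"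
  shows "norm (f i) \<le> r"
proof -
  \<comment> \<open>The total weight of the fibre of \<open>f\<close> over \<open>w\<close>;
    grouping by fibres makes the nodes distinct.\<close>
  define c :: "complex \<Rightarrow> complex" where "c w = of_nat (\<Sum>s | s \<in> I \<and> f s = w. m s)" for w
  have "(\<Sum>s\<in>I. of_nat (m s) * f s ^ n) = (\<Sum>w\<in>f ` I. c w * w ^ n)" for n
    by (subst sum.image_gen[OF fin, of _ f])
      (auto simp: c_def sum_distrib_right intro!: sum.cong)
  moreover have "(\<Sum>s | s \<in> I \<and> f s = f i. m s) > 0"
    using fin \<open>i \<in> I\<close> pos by (intro sum_pos2[of _ i]) auto
  then have "c (f i) \<noteq> 0"
    unfolding c_def by (simp only: of_nat_eq_0_iff)
  ultimately show ?thesis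
    using assms by (intro power_sum_bounded_imp_node_le[of "f ` I" _ c r C]) auto
qed


section \<open>The Hodge index argument\<close>

text \<open>The primitive form is minus \<open>\<beta>\<close> on the component of \<open>x\<close>
  orthogonal to the hyperbolic plane of \<open>v01\<close> and \<open>v10\<close>. That plane
  already contains a positive direction, and the Hodge property leaves no room for a second
  one.\<close>

lemma primitive_form_nonneg:
  fixes \<beta> :: "'v::real_vector \<Rightarrow> 'v \<Rightarrow> real"
  assumes bil: "bilinear \<beta>" and sym: "\<And>x y. \<beta> x y = \<beta> y x" and hodge: "INT2 \<beta> h"
    and plane: "\<beta> v01 v01 = 0" "\<beta> v10 v10 = 0" "\<beta> v01 v10 = 1"
  shows "primitive_form \<beta> v01 v10 x x \<ge> 0"
proof (rule ccontr)
  note expand = bilinear_ladd[OF bil] bilinear_radd[OF bil] bilinear_lsub[OF bil]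
    bilinear_rsub[OF bil] bilinear_lmul[OF bil] bilinear_rmul[OF bil]
  assume neg: "\<not> primitive_form \<beta> v01 v10 x x \<ge> 0"
  \<comment> \<open>\<open>y\<close> is the component of \<open>x\<close> orthogonal to the
    hyperbolic plane, and \<open>u\<close> is a positive vector inside that plane.\<close>
  define y where "y = x - \<beta> x v10 *\<^sub>R v01 - \<beta> x v01 *\<^sub>R v10"
  define u where "u = v01 + v10"
  have plane': "\<beta> v10 v01 = 1"
    using plane(3) sym by metis
  have "\<beta> y y = - primitive_form \<beta> v01 v10 x x"
    using plane plane' sym[of v01 x] sym[of v10 x]
    by (simp add: y_def primitive_form_def expand algebra_simps)
  then have yy: "\<beta> y y > 0" using neg by simp
  have uu: "\<beta> u u = 2"
    using plane plane' by (simp add: u_def expand)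
  have uy: "\<beta> y u = 0" "\<beta> u y = 0"
    using plane plane' sym[of v01 x] sym[of v10 x] by (simp_all add: u_def y_def expand)
  \<comment> \<open>The positive definite plane spanned by \<open>y\<close> and \<open>u\<close> meets the hyperplane orthogonal to \<open>h\<close>.\<close>
  define z where "z = \<beta> u h *\<^sub>R y - \<beta> y h *\<^sub>R u"
  have "\<beta> z h = 0"
    by (simp add: z_def expand)
  then have "\<beta> z z \<le> 0"
    using hodge by (simp add: INT2_def)
  moreover have "\<beta> z z = (\<beta> u h)\<^sup>2 * \<beta> y y + 2 * (\<beta> y h)\<^sup>2"
    by (simp add: z_def expand uu uy power2_eq_square algebra_simps)
  moreover have "(\<beta> u h)\<^sup>2 * \<beta> y y \<ge> 0" using yy by simp
  \<comment> \<open>Both summands of \<open>\<beta> z z\<close> are nonnegative, so they vanish.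
    Then \<open>u\<close> is orthogonal to \<open>h\<close> although
    \<open>\<beta> u u = 2\<close>.\<close>
  ultimately have "(\<beta> u h)\<^sup>2 * \<beta> y y = 0"
    by (smt (verit) zero_le_power2)
  then have "\<beta> u h = 0" using yy by simp
  then show False
    using hodge uu unfolding INT2_def by fastforce
qed

text \<open>The discriminant argument, evaluated at the minimum of a quadratic in \<open>t\<close>.
  The form is only known to be semidefinite, so an isotropic \<open>y\<close> is treated
  separately.\<close>

lemma primitive_form_Cauchy_Schwarz:
  fixes \<beta> :: "'v::real_vector \<Rightarrow> 'v \<Rightarrow> real"
  assumes bil: "bilinear \<beta>" and sym: "\<And>x y. \<beta> x y = \<beta> y x" and hodge: "INT2 \<beta> h"
    and plane: "\<beta> v01 v01 = 0" "\<beta> v10 v10 = 0" "\<beta> v01 v10 = 1"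
  defines "P \<equiv> primitive_form \<beta> v01 v10"
  shows "(P x y)\<^sup>2 \<le> P x x * P y y"
proof -
  have quad: "0 \<le> P x x + 2 * t * P x y + t\<^sup>2 * P y y" for t
  proof -
    have "P (x + t *\<^sub>R y) (x + t *\<^sub>R y) = P x x + 2 * t * P x y + t\<^sup>2 * P y y"
      using sym[of y x]
      by (simp add: P_def primitive_form_def bilinear_ladd[OF bil] bilinear_radd[OF bil]
          bilinear_lmul[OF bil] bilinear_rmul[OF bil] power2_eq_square algebra_simps)
    then show ?thesis
      using primitive_form_nonneg[OF bil sym hodge plane] unfolding P_def by metis
  qed
  show ?thesis
  proof (cases "P y y = 0")
    case True
    have "P x y = 0"
    proof (rule ccontr)
      assume "P x y \<noteq> 0"
      \<comment> \<open>The bound \<open>quad\<close> is affine in \<open>t\<close> here, and this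
        value of \<open>t\<close> makes it equal to -1.\<close>
      then show False
        using quad[of "- (P x x + 1) / (2 * P x y)"] quad[of 0] True by (simp add: field_simps)
    qed
    then show ?thesis using True by simp
  next
    case False
    then have pos: "P y y > 0"
      using primitive_form_nonneg[OF bil sym hodge plane, of y] by (simp add: P_def)
    have "0 \<le> P x x - (P x y)\<^sup>2 / P y y"
      using quad[of "- P x y / P y y"] pos by (simp add: power2_eq_square field_simps)
    then show ?thesis using pos by (simp add: field_simps)
  qed
qed


section \<open>Multiplicities and the spectrum\<close>

text \<open>Riesz index 1 identifies the range of the projection with the kernel of
  \<open>s - A\<close>, which contains an eigenvector. The finite spanning set matters because
  \<open>dim\<close> is 0 on infinite-dimensional spaces.\<close>

lemma alg_mult_pos:
  assumes "OP3 D A" "s \<in> point_spectrum D A"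
  shows "alg_mult D A s > 0"
proof -
  let ?R = "range (riesz_projection D A {s})"
  let ?N = "{\<nu>. 0 < \<nu> \<and> kernel_power D A s \<nu> = ?R}"
  obtain B where B: "finite B" "complex_vs.span B = ?R"
    using assms by (auto simp: OP3_def)
  have idx: "Inf (enat ` ?N) = 1"
    using assms by (auto simp: OP3_def riesz_index_def)
  \<comment> \<open>In \<open>enat\<close> the infimum of the empty set is infinity, so the value 1
    shows that some exponent exists and that the infimum is attained.\<close>
  then have "enat ` ?N \<noteq> {}"
    by (intro notI) (simp add: Inf_enat_def one_enat_def)
  then obtain k where "k \<in> enat ` ?N"
    by blast
  then have "Inf (enat ` ?N) \<in> enat ` ?N"
    by (rule wellorder_InfI)
  then have ker: "kernel_power D A s 1 = ?R"
    unfolding idx one_enat_def by auto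
  obtain x where x: "x \<in> D" "x \<noteq> 0" "A x = s *\<^sub>C x"
    using assms(2) by (auto simp: point_spectrum_def)
  then have "x \<in> ?R"
    unfolding ker[symmetric] by (simp add: kernel_power_def shifted_def)
  obtain B' where B': "B' \<subseteq> B" "complex_vs.independent B'" "B \<subseteq> complex_vs.span B'"
      "card B' = complex_vs.dim B"
    by (rule complex_vs.basis_exists)
  have "complex_vs.span B \<subseteq> complex_vs.span B'"
    by (rule complex_vs.span_minimal[OF B'(3) complex_vs.subspace_span])
  then have "B' \<noteq> {}"
    using \<open>x \<in> ?R\<close> x(2) B(2) by auto
  then have "card B' > 0"
    using B(1) B'(1) by (simp add: card_gt_0_iff finite_subset)
  then show ?thesis
    using B'(4) B(2) by (metis alg_mult_def complex_vs.dim_span)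
qed

text \<open>The cut-off lies in a compact rectangle, where an infinite set would accumulate.\<close>

lemma finite_spectrum_cutoff:
  assumes "OP2 D A" "OP4 D A"
  shows "finite (spectrum_cutoff D A Y)"
proof (rule ccontr)
  assume inf: "infinite (spectrum_cutoff D A Y)"
  have "spectrum_cutoff D A Y \<subseteq> cbox (Complex 0 (- Y)) (Complex 1 Y)"
    using assms(2)
    by (fastforce simp: spectrum_cutoff_def OP4_def Omega_infinity_def in_cbox_complex_iff)
  then have "bounded (spectrum_cutoff D A Y)"
    using bounded_cbox bounded_subset by blast
  with inf obtain z where "z islimpt spectrum_cutoff D A Y"
    using bounded_infinite_imp_islimpt[OF order_refl] by blast
  then have "z islimpt spectrum D A"
    by (rule islimpt_subset) (auto simp: spectrum_cutoff_def)
  then show False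
    using assms(1) unfolding OP2_def by blast
qed

lemma cutoff_function_cases:
  assumes "cutoff_function D A Y \<phi>"
  obtains q where "q > 0" "q \<noteq> 1" "\<phi> 1 = complex_of_real q"
    "\<And>s. s \<in> spectrum_cutoff D A Y \<Longrightarrow> norm (\<phi> s) = q powr Re s"
proof -
  obtain q where q: "q \<in> {0<..<1} \<union> {1<..}" "\<phi> 1 = complex_of_real q"
    using assms by (auto simp: cutoff_function_def)
  have "norm (\<phi> s) = q powr Re s" if "s \<in> spectrum_cutoff D A Y" for s
  proof -
    have "\<phi> s = complex_of_real q powr s"
      using assms that q by (simp add: cutoff_function_def)
    then show ?thesis using q by (auto simp: norm_powr_real_powr)
  qed
  then show ?thesis using that[of q] q by auto
qed

text \<open>The summands vanish outside \<open>K\<close>; this uses \<open>n \<ge> 1\<close>, since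
  \<open>0 ^ 0 = 1\<close>.\<close>

lemma trace_finite_support:
  assumes "finite K" "K \<subseteq> spectrum D A" "\<forall>s\<in>spectrum D A - K. \<phi> s = 0" "n \<ge> 1"
  shows "trace_power_finite D A \<phi> n"
    and "trace_power D A \<phi> n = (\<Sum>s\<in>K. of_nat (alg_mult D A s) * \<phi> s ^ n)"
proof -
  let ?f = "\<lambda>s. of_nat (alg_mult D A s) * \<phi> s ^ n"
  have "?f summable_on spectrum D A \<longleftrightarrow> ?f summable_on K"
    by (rule summable_on_cong_neutral) (use assms in auto)
  then show "trace_power_finite D A \<phi> n"
    using assms(1) by (simp add: trace_power_finite_def)
  have "infsum ?f (spectrum D A) = infsum ?f K"
    by (rule infsum_cong_neutral) (use assms in auto)
  then show "trace_power D A \<phi> n = sum ?f K"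
    using assms(1) by (simp add: trace_power_def)
qed


section \<open>Intersection theories imply the Riemann Hypothesis\<close>

text \<open>As \<open>norm (\<phi> Y s) = q powr Re s\<close>, the bound reads
  \<open>Re s \<le> 1/2\<close> if \<open>q > 1\<close> and \<open>Re s \<ge> 1/2\<close> if
  \<open>q < 1\<close>.\<close>

lemma intersection_theory_imp_one_sided:
  fixes A :: "'h::complex_hilbert_space \<Rightarrow> 'h" and \<phi> :: "real \<Rightarrow> complex \<Rightarrow> complex"
  assumes "OP2 D A" "OP3 D A" "OP4 D A" "Y > 0"
    and cut: "cutoff_function D A Y (\<phi> Y)"
    and int: "admits_intersection_theory TYPE('v::real_vector) D A \<phi>"
    and s: "s \<in> spectrum_cutoff D A Y"
  shows "norm (\<phi> Y s) \<le> sqrt (Re (\<phi> Y 1))"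
proof -
  obtain \<beta> :: "'v \<Rightarrow> 'v \<Rightarrow> real" and v01 v10 h S v\<delta> \<Phi> where
    bil: "bilinear \<beta>" and sym: "\<And>x y. \<beta> x y = \<beta> y x" and mem: "\<phi> Y \<in> S" and
    i1: "INT1 \<beta> v01 v10 v\<delta> \<Phi> \<phi>" and i2: "INT2 \<beta> h" and i3: "INT3 D A \<beta> v01 v10 S v\<delta> \<Phi>"
    using int \<open>Y > 0\<close> unfolding admits_intersection_theory_def by blast
  obtain q where q: "q > 0" "\<phi> Y 1 = complex_of_real q"
    using cutoff_function_cases[OF cut] by blast
  define v where "v = v\<delta> (\<phi> Y)"
  define T where "T = \<Phi> (\<phi> Y)"
  define P where "P = primitive_form \<beta> v01 v10"
  let ?K = "spectrum_cutoff D A Y" and ?x = "\<lambda>n. (T ^^ n) v"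
  have plane: "\<beta> v01 v01 = 0" "\<beta> v10 v10 = 0" "\<beta> v01 v10 = 1"
    using i1 by (auto simp: INT1_def)
  have orbit: "\<And>n. \<beta> (?x n) v01 = 1"
      "(\<lambda>n. \<beta> (?x n) v10) \<in> O(\<lambda>n. q ^ n)" "(\<lambda>n. \<beta> (?x n) (?x n)) \<in> O(\<lambda>n. q ^ n)"
    using i1 \<open>Y > 0\<close> q(2) by (auto simp: INT1_def Let_def v_def T_def)
  \<comment> \<open>The pairing with \<open>v01\<close> is constantly 1, so the products in the
    primitive form become linear and (INT1) bounds them.\<close>
  have "(\<lambda>n. P (?x n) (?x n)) = (\<lambda>n. 2 * \<beta> (?x n) v10 - \<beta> (?x n) (?x n))"
    using orbit(1) by (simp add: P_def primitive_form_def)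
  also have "\<dots> \<in> O(\<lambda>n. q ^ n)"
    using orbit(2,3) by (intro sum_in_bigo(2)) auto
  finally obtain C where C: "\<forall>\<^sub>F n in sequentially. norm (P (?x n) (?x n)) \<le> C * norm (q ^ n)"
    by (auto elim!: landau_o.bigE)
  define M where "M = sqrt (C * P v v)"
  have trace: "(\<Sum>s\<in>?K. of_nat (alg_mult D A s) * \<phi> Y s ^ n) = complex_of_real (P (?x n) v)"
    if "n \<ge> 1" for n
  proof -
    note fin = finite_spectrum_cutoff[OF \<open>OP2 D A\<close> \<open>OP4 D A\<close>, of Y]
    have "?K \<subseteq> spectrum D A" "\<forall>s\<in>spectrum D A - ?K. \<phi> Y s = 0"
      using cut by (auto simp: cutoff_function_def spectrum_cutoff_def)
    from trace_finite_support[OF fin this that] show ?thesis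
      using i3 mem unfolding INT3_def P_def T_def v_def by auto
  qed
  have "\<forall>\<^sub>F n in sequentially. norm (\<Sum>s\<in>?K. of_nat (alg_mult D A s) * \<phi> Y s ^ n) \<le> M * sqrt q ^ n"
    using C eventually_ge_at_top[of 1]
  proof eventually_elim
    case (elim n)
    have vv: "P v v \<ge> 0"
      using primitive_form_nonneg[OF bil sym i2 plane] by (simp add: P_def)
    \<comment> \<open>Only the first factor on the right grows with \<open>n\<close>; the square
      root therefore halves the growth exponent.\<close>
    have "(P (?x n) v)\<^sup>2 \<le> P (?x n) (?x n) * P v v"
      using primitive_form_Cauchy_Schwarz[OF bil sym i2 plane] by (simp add: P_def)
    also have "\<dots> \<le> (C * q ^ n) * P v v"
      using elim q(1) vv by (intro mult_right_mono) auto
    finally have "\<bar>P (?x n) v\<bar> \<le> sqrt (C * P v v * q ^ n)"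
      by (intro real_le_rsqrt) (simp add: mult_ac)
    also have "\<dots> = M * sqrt q ^ n"
      by (simp add: M_def real_sqrt_mult real_sqrt_power)
    finally show ?case
      using trace elim by simp
  qed
  moreover have "alg_mult D A s > 0" if "s \<in> ?K" for s
    using that assms(1,2) by (intro alg_mult_pos) (auto simp: OP2_def spectrum_cutoff_def)
  ultimately have "norm (\<phi> Y s) \<le> sqrt q"
    using finite_spectrum_cutoff[OF assms(1,3)] s q(1)
    by (intro weighted_power_sum_bounded_imp_node_le[of ?K s "alg_mult D A" "sqrt q" "\<phi> Y" M]) auto
  then show ?thesis using q(2) by simp
qed

theorem intersection_theory_imp_riemann_hypothesis:
  fixes A :: "'h::complex_hilbert_space \<Rightarrow> 'h" and \<phi> :: "real \<Rightarrow> complex \<Rightarrow> complex"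
  assumes "OP2 D A" "OP3 D A" "OP4 D A" "OP5 D A"
    and cut: "\<And>Y. Y > 0 \<Longrightarrow> cutoff_function D A Y (\<phi> Y)"
    and int: "admits_intersection_theory TYPE('v::real_vector) D A \<phi>"
  shows "riemann_hypothesis D A"
proof (rule ccontr)
  assume "\<not> riemann_hypothesis D A"
  then obtain s where "s \<in> spectrum D A" "Re s < 1 / 2 \<or> Re s > 1 / 2"
    unfolding riemann_hypothesis_def by force
  then obtain a b where ab: "a \<in> spectrum D A" "Re a < 1 / 2" "b \<in> spectrum D A" "Re b > 1 / 2"
    using \<open>OP5 D A\<close> unfolding OP5_def by metis
  \<comment> \<open>One cut-off must contain both points, since the admissible side depends on
    \<open>q\<close> and hence on \<open>Y\<close>.\<close>
  define Y where "Y = \<bar>Im a\<bar> + \<bar>Im b\<bar> + 1"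
  have Y: "Y > 0" "a \<in> spectrum_cutoff D A Y" "b \<in> spectrum_cutoff D A Y"
    using ab by (auto simp: Y_def spectrum_cutoff_def)
  obtain q where q: "q > 0" "q \<noteq> 1" "\<phi> Y 1 = complex_of_real q"
    and norm: "\<And>s. s \<in> spectrum_cutoff D A Y \<Longrightarrow> norm (\<phi> Y s) = q powr Re s"
    using cutoff_function_cases[OF cut[OF Y(1)]] by metis
  have le: "q powr Re s \<le> q powr (1 / 2)" if "s \<in> spectrum_cutoff D A Y" for s
    using intersection_theory_imp_one_sided[OF assms(1-3) Y(1) cut[OF Y(1)] int that] norm[OF that] q
    by (simp add: powr_half_sqrt)
  show False
  proof (cases "q > 1")
    case True
    then show ?thesis using le[OF Y(3)] ab(4) by simp
  next
    case False
    then have "q powr (1 / 2) < q powr Re a"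
      using q ab(2) by (intro powr_less_mono') auto
    then show ?thesis using le[OF Y(2)] by simp
  qed
qed


section \<open>The intersection theory of a critical spectrum\<close>

text \<open>The simplifier would turn the vector \<open>single 0 1\<close> into the unit of the convolution ring.\<close>

declare single_one [simp del]

section \<open>The bilinear form on finitely supported functions\<close>

lemma lookup_scaleR: "Poly_Mapping.lookup (r *\<^sub>R x) s = r *\<^sub>R Poly_Mapping.lookup x s"
proof -
  have "finite {s. r *\<^sub>R Poly_Mapping.lookup x s \<noteq> 0}"
    by (rule finite_subset[OF _ finite_lookup[of x]]) auto
  then show ?thesis by (simp add: scaleR_poly_mapping_def)
qed

text \<open>The sum ranges over the keys of \<open>x\<close> to stay finite for infinite
  \<open>\<Sigma>\<close>.\<close>

definition spectral_form ::
  "complex set \<Rightarrow> (complex \<Rightarrow> nat) \<Rightarrow> (complex \<Rightarrow>\<^sub>0 complex) \<Rightarrow> (complex \<Rightarrow>\<^sub>0 complex) \<Rightarrow> real" where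
  "spectral_form \<Sigma> m x y =
     Re (Poly_Mapping.lookup x 0) * Re (Poly_Mapping.lookup y 1) +
     Re (Poly_Mapping.lookup x 1) * Re (Poly_Mapping.lookup y 0) -
     (\<Sum>s\<in>Poly_Mapping.keys x \<inter> \<Sigma>.
        real (m s) * Re (Poly_Mapping.lookup x s * cnj (Poly_Mapping.lookup y s)))"

text \<open>Terms vanish wherever either argument does. This frees the index set from the keys of
  \<open>x\<close>: a set depending on \<open>y\<close> alone gives linearity in \<open>x\<close>,
  and a common one gives symmetry.\<close>

lemma spectral_form_superset:
  assumes "finite K" "Poly_Mapping.keys x \<inter> \<Sigma> \<subseteq> K \<or> Poly_Mapping.keys y \<inter> \<Sigma> \<subseteq> K" "K \<subseteq> \<Sigma>"
  shows "spectral_form \<Sigma> m x y =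
     Re (Poly_Mapping.lookup x 0) * Re (Poly_Mapping.lookup y 1) +
     Re (Poly_Mapping.lookup x 1) * Re (Poly_Mapping.lookup y 0) -
     (\<Sum>s\<in>K. real (m s) * Re (Poly_Mapping.lookup x s * cnj (Poly_Mapping.lookup y s)))"
proof -
  let ?f = "\<lambda>s. real (m s) * Re (Poly_Mapping.lookup x s * cnj (Poly_Mapping.lookup y s))"
  have zero: "?f s = 0" if "s \<notin> Poly_Mapping.keys x \<inter> Poly_Mapping.keys y" for s
    using that by (auto simp: in_keys_iff)
  have "sum ?f (Poly_Mapping.keys x \<inter> \<Sigma>) = sum ?f (Poly_Mapping.keys x \<inter> Poly_Mapping.keys y \<inter> \<Sigma>)"
    by (intro sum.mono_neutral_right ballI zero) auto
  also have "\<dots> = sum ?f K"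
    using assms by (intro sum.mono_neutral_left ballI zero) auto
  finally show ?thesis by (simp add: spectral_form_def)
qed

lemma spectral_form_commute: "spectral_form \<Sigma> m x y = spectral_form \<Sigma> m y x"
  by (subst (1 2) spectral_form_superset[of "(Poly_Mapping.keys x \<union> Poly_Mapping.keys y) \<inter> \<Sigma>"])
    (auto simp: algebra_simps)

lemma bilinear_spectral_form: "bilinear (spectral_form \<Sigma> m)"
proof -
  have lin: "linear (\<lambda>x. spectral_form \<Sigma> m x y)" for y
    by (intro linearI; subst spectral_form_superset[of "Poly_Mapping.keys y \<inter> \<Sigma>"])+
      (auto simp: lookup_add lookup_scaleR spectral_form_superset[of "Poly_Mapping.keys y \<inter> \<Sigma>"]
        algebra_simps sum.distrib sum_distrib_left sum_subtractf)
  have "spectral_form \<Sigma> m x = (\<lambda>y. spectral_form \<Sigma> m y x)" for x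
    by (rule ext) (rule spectral_form_commute)
  then show ?thesis
    unfolding bilinear_def using lin by metis
qed

text \<open>The hyperbolic form pairs coordinate 0 with coordinate 1. Here \<open>single 1 1\<close>
  takes the role of \<open>v01\<close> and \<open>single 0 1\<close> that of
  \<open>v10\<close>.\<close>

lemma spectral_form_plane:
  assumes "0 \<notin> \<Sigma>" "1 \<notin> \<Sigma>"
  shows "spectral_form \<Sigma> m x (Poly_Mapping.single 1 1) = Re (Poly_Mapping.lookup x 0)"
    and "spectral_form \<Sigma> m x (Poly_Mapping.single 0 1) = Re (Poly_Mapping.lookup x 1)"
  using assms by (subst spectral_form_superset[of "{}"]; simp add: lookup_single)+

text \<open>The hyperbolic part cancels and the spectral part changes sign.\<close>

lemma primitive_spectral_form:
  assumes "0 \<notin> \<Sigma>" "1 \<notin> \<Sigma>" "finite K" "K \<subseteq> \<Sigma>" "Poly_Mapping.keys y \<inter> \<Sigma> \<subseteq> K"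
  shows "primitive_form (spectral_form \<Sigma> m) (Poly_Mapping.single 1 1) (Poly_Mapping.single 0 1) x y =
    (\<Sum>s\<in>K. real (m s) * Re (Poly_Mapping.lookup x s * cnj (Poly_Mapping.lookup y s)))"
  unfolding primitive_form_def spectral_form_plane[OF assms(1,2)]
    spectral_form_superset[OF assms(3) disjI2[OF assms(5)] assms(4)]
  by simp

text \<open>Orthogonality to this positive vector forces opposite real parts at 0 and 1, so the
  plane contributes minus twice a square.\<close>

lemma INT2_spectral_form:
  assumes "0 \<notin> \<Sigma>" "1 \<notin> \<Sigma>"
  shows "INT2 (spectral_form \<Sigma> m) (Poly_Mapping.single 1 1 + Poly_Mapping.single 0 1)"
  unfolding INT2_def
proof (intro allI impI)
  fix x
  assume "spectral_form \<Sigma> m x (Poly_Mapping.single 1 1 + Poly_Mapping.single 0 1) = 0"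
  then have "Re (Poly_Mapping.lookup x 1) = - Re (Poly_Mapping.lookup x 0)"
    using assms by (simp add: bilinear_radd[OF bilinear_spectral_form] spectral_form_plane)
  moreover have "(\<Sum>s\<in>Poly_Mapping.keys x \<inter> \<Sigma>.
      real (m s) * Re (Poly_Mapping.lookup x s * cnj (Poly_Mapping.lookup x s))) \<ge> 0"
    by (intro sum_nonneg mult_nonneg_nonneg) auto
  ultimately show "spectral_form \<Sigma> m x x \<le> 0"
    by (simp add: spectral_form_def) (smt (verit) zero_le_square)
qed

section \<open>Multiplication operators and the algebra of finite spectral support\<close>

definition multiplication_operator ::
  "(complex \<Rightarrow> complex) \<Rightarrow> (complex \<Rightarrow>\<^sub>0 complex) \<Rightarrow> complex \<Rightarrow>\<^sub>0 complex" where
  "multiplication_operator \<phi> = Poly_Mapping.mapp (\<lambda>s z. \<phi> s * z)"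

lemma lookup_multiplication_operator [simp]:
  "Poly_Mapping.lookup (multiplication_operator \<phi> x) s = \<phi> s * Poly_Mapping.lookup x s"
  by (simp add: multiplication_operator_def lookup_mapp in_keys_iff when_def)

lemma lookup_multiplication_operator_power [simp]:
  "Poly_Mapping.lookup ((multiplication_operator \<phi> ^^ n) x) s = \<phi> s ^ n * Poly_Mapping.lookup x s"
  by (induction n) simp_all

lemma real_algebra_hom_multiplication_operator: "real_algebra_hom S multiplication_operator"
  unfolding real_algebra_hom_def
  by (auto simp: fun_eq_iff algebra_simps lookup_add lookup_scaleR scaleR_conv_of_real
      intro!: linearI poly_mapping_eqI)

text \<open>Large enough to contain the cut-off functions, small enough that traces of positive
  powers are finite sums.\<close>

definition finite_spectral_support ::
  "'h::complex_hilbert_space set \<Rightarrow> ('h \<Rightarrow> 'h) \<Rightarrow> (complex \<Rightarrow> complex) set" where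
  "finite_spectral_support D A =
     {\<phi>\<in>function_algebra D A. finite {s\<in>spectrum D A. \<phi> s \<noteq> 0}}"

lemma real_subalgebra_finite_spectral_support:
  "real_subalgebra (finite_spectral_support D A) (function_algebra D A)"
proof -
  have fin: "finite {s\<in>spectrum D A. \<eta> s \<noteq> 0}"
    if "finite {s\<in>spectrum D A. \<phi> s \<noteq> 0}" "finite {s\<in>spectrum D A. \<psi> s \<noteq> 0}"
      "\<And>s. \<phi> s = 0 \<Longrightarrow> \<psi> s = 0 \<Longrightarrow> \<eta> s = 0" for \<phi> \<psi> \<eta> :: "complex \<Rightarrow> complex"
    by (rule finite_subset[OF _ finite_UnI[OF that(1,2)]]) (use that(3) in auto)
  have alg: "(\<lambda>s. \<phi> s + \<psi> s) \<in> function_algebra D A" "(\<lambda>s. \<phi> s * \<psi> s) \<in> function_algebra D A"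
    if "\<phi> \<in> function_algebra D A" "\<psi> \<in> function_algebra D A" for \<phi> \<psi>
  proof -
    obtain U V where "open U" "closure Omega_infinity \<subseteq> U" "\<phi> holomorphic_on U"
      "open V" "closure Omega_infinity \<subseteq> V" "\<psi> holomorphic_on V"
      using \<open>\<phi> \<in> _\<close> \<open>\<psi> \<in> _\<close> by (auto simp: function_algebra_def)
    then have "open (U \<inter> V) \<and> closure Omega_infinity \<subseteq> U \<inter> V \<and>
        (\<lambda>s. \<phi> s + \<psi> s) holomorphic_on U \<inter> V \<and> (\<lambda>s. \<phi> s * \<psi> s) holomorphic_on U \<inter> V"
      by (auto intro!: holomorphic_intros intro: holomorphic_on_subset)
    with that show "(\<lambda>s. \<phi> s + \<psi> s) \<in> function_algebra D A"
        "(\<lambda>s. \<phi> s * \<psi> s) \<in> function_algebra D A"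
      unfolding function_algebra_def by auto
  qed
  have const: "(\<lambda>s. of_real r) \<in> function_algebra D A" for r
    unfolding function_algebra_def by (auto intro!: exI[of _ UNIV])
  show ?thesis
    unfolding real_subalgebra_def
  proof (intro conjI ballI allI)
    show "finite_spectral_support D A \<subseteq> function_algebra D A"
      by (auto simp: finite_spectral_support_def)
    show "(\<lambda>s. 0) \<in> finite_spectral_support D A"
      using const[of 0] by (simp add: finite_spectral_support_def)
  next
    fix \<phi> \<psi> assume "\<phi> \<in> finite_spectral_support D A" "\<psi> \<in> finite_spectral_support D A"
    then show "(\<lambda>s. \<phi> s + \<psi> s) \<in> finite_spectral_support D A"
        "(\<lambda>s. \<phi> s * \<psi> s) \<in> finite_spectral_support D A"
      using alg[of \<phi> \<psi>] fin[of \<phi> \<psi> "\<lambda>s. \<phi> s + \<psi> s"] fin[of \<phi> \<psi> "\<lambda>s. \<phi> s * \<psi> s"]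
      by (auto simp: finite_spectral_support_def)
  next
    fix r :: real and \<phi> assume "\<phi> \<in> finite_spectral_support D A"
    then show "(\<lambda>s. of_real r * \<phi> s) \<in> finite_spectral_support D A"
      using alg(2)[OF const, of \<phi> r] fin[of \<phi> \<phi> "\<lambda>s. of_real r * \<phi> s"]
      by (auto simp: finite_spectral_support_def)
  qed
qed

section \<open>Traces and the Lefschetz formula\<close>

text \<open>Conjugation permutes the spectrum, preserves multiplicities and commutes with
  \<open>\<phi>\<close> there. The real-valued form can thus recover the trace from its real
  part.\<close>

lemma trace_power_real:
  assumes "OP5 D A" "\<phi> \<in> function_algebra D A"
  shows "trace_power D A \<phi> n \<in> \<real>"
proof -
  let ?f = "\<lambda>s. of_nat (alg_mult D A s) * \<phi> s ^ n"
  have bij: "bij_betw cnj (spectrum D A) (spectrum D A)"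
    using assms(1) by (intro bij_betwI[of _ _ _ cnj]) (auto simp: OP5_def)
  have "cnj (trace_power D A \<phi> n) = infsum (\<lambda>s. cnj (?f s)) (spectrum D A)"
    unfolding trace_power_def by (rule infsum_cnj[symmetric])
  also have "\<dots> = infsum (\<lambda>s. ?f (cnj s)) (spectrum D A)"
    using assms by (intro infsum_cong) (simp add: OP5_def function_algebra_def)
  also have "\<dots> = trace_power D A \<phi> n"
    unfolding trace_power_def by (rule infsum_reindex_bij_betw[OF bij])
  finally show ?thesis by (simp add: Reals_cnj_iff)
qed

text \<open>At exponent 0 every eigenvalue contributes its multiplicity, hence at least 1;
  \<open>N\<close> eigenvalues would already exceed the total.\<close>

lemma trace_power_0_finite_imp_finite_spectrum:
  assumes "OP2 D A" "OP3 D A" "trace_power_finite D A \<phi> 0"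
  shows "finite (spectrum D A)"
proof (rule ccontr)
  let ?m = "\<lambda>s. real (alg_mult D A s)"
  assume "infinite (spectrum D A)"
  define N where "N = nat \<lceil>infsum ?m (spectrum D A)\<rceil> + 1"
  obtain F where F: "F \<subseteq> spectrum D A" "card F = N" "finite F"
    using infinite_arbitrarily_large[OF \<open>infinite (spectrum D A)\<close>] by metis
  have sm: "?m summable_on spectrum D A"
    using summable_on_Re[OF assms(3)[unfolded trace_power_finite_def]] by simp
  have "real N = (\<Sum>s\<in>F. 1)"
    using F by simp
  also have "\<dots> \<le> sum ?m F"
  proof (intro sum_mono)
    fix s assume "s \<in> F"
    then have "alg_mult D A s > 0"
      using F(1) assms(1,2) by (intro alg_mult_pos) (auto simp: OP2_def)
    then show "1 \<le> ?m s" by simp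
  qed
  also have "\<dots> \<le> infsum ?m (spectrum D A)"
    using F sm by (intro finite_sum_le_infsum) auto
  finally show False
    unfolding N_def by linarith
qed

text \<open>For finite spectrum the Lefschetz formula at \<open>n = 0\<close> asks for the total multiplicity, so the
  zeros of \<open>\<phi>\<close> must be included.\<close>

definition trace_support ::
  "'h::complex_hilbert_space set \<Rightarrow> ('h \<Rightarrow> 'h) \<Rightarrow> (complex \<Rightarrow> complex) \<Rightarrow> complex set" where
  "trace_support D A \<phi> =
     (if finite (spectrum D A) then spectrum D A else {s\<in>spectrum D A. \<phi> s \<noteq> 0})"

text \<open>The ones on the trace support make the spectral pairing with an orbit vector a trace
  sum. The ones at 0 and 1 make the pairings with \<open>v01\<close> and \<open>v10\<close> equal to
  \<open>1\<close> and \<open>q ^ n\<close> for a cut-off function.\<close>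

definition diagonal_vector ::
  "'h::complex_hilbert_space set \<Rightarrow> ('h \<Rightarrow> 'h) \<Rightarrow> (complex \<Rightarrow> complex) \<Rightarrow> complex \<Rightarrow>\<^sub>0 complex" where
  "diagonal_vector D A \<phi> =
     Abs_poly_mapping (\<lambda>s. if s \<in> trace_support D A \<phi> \<union> {0, 1} then 1 else 0)"

lemma trace_support_props:
  assumes "\<phi> \<in> finite_spectral_support D A"
  shows "finite (trace_support D A \<phi>)" "trace_support D A \<phi> \<subseteq> spectrum D A"
    "\<forall>s\<in>spectrum D A - trace_support D A \<phi>. \<phi> s = 0"
  using assms by (auto simp: trace_support_def finite_spectral_support_def split: if_splits)

lemma lookup_diagonal_vector:
  assumes "\<phi> \<in> finite_spectral_support D A"
  shows "Poly_Mapping.lookup (diagonal_vector D A \<phi>) s =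
    (if s \<in> trace_support D A \<phi> \<union> {0, 1} then 1 else 0)"
proof -
  have "finite {s. (if s \<in> trace_support D A \<phi> \<union> {0, 1} then 1 else 0 :: complex) \<noteq> 0}"
    by (rule finite_subset[of _ "trace_support D A \<phi> \<union> {0, 1}"])
      (use trace_support_props(1)[OF assms] in auto)
  then show ?thesis by (simp add: diagonal_vector_def)
qed

lemma strip_excludes_endpoints:
  assumes "OP4 D A"
  shows "0 \<notin> spectrum D A" "1 \<notin> spectrum D A"
  using assms by (auto simp: OP4_def Omega_infinity_def)

lemma keys_diagonal_vector:
  assumes "OP4 D A" "\<phi> \<in> finite_spectral_support D A"
  shows "Poly_Mapping.keys (diagonal_vector D A \<phi>) \<inter> spectrum D A = trace_support D A \<phi>"
  using strip_excludes_endpoints[OF assms(1)] trace_support_props(2)[OF assms(2)]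
  by (auto simp: in_keys_iff lookup_diagonal_vector[OF assms(2)] split: if_splits)

lemma INT3_spectral_form:
  assumes "OP2 D A" "OP3 D A" "OP4 D A" "OP5 D A"
  shows "INT3 D A (spectral_form (spectrum D A) (alg_mult D A))
    (Poly_Mapping.single 1 1) (Poly_Mapping.single 0 1)
    (finite_spectral_support D A) (diagonal_vector D A) multiplication_operator"
  unfolding INT3_def
proof (intro ballI conjI allI impI)
  fix \<phi> and n :: nat assume \<phi>: "\<phi> \<in> finite_spectral_support D A"
  note K = trace_support_props[OF \<phi>]
  show "trace_power_finite D A \<phi> n" if "n \<ge> 1"
    using trace_finite_support(1)[OF K that] .
  assume fin: "trace_power_finite D A \<phi> n"
  have tr: "trace_power D A \<phi> n = (\<Sum>s\<in>trace_support D A \<phi>. of_nat (alg_mult D A s) * \<phi> s ^ n)"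
  proof (cases "n \<ge> 1")
    case True
    then show ?thesis by (rule trace_finite_support(2)[OF K])
  next
    case False
    \<comment> \<open>Here \<open>n = 0\<close>: a finite trace forces a finite spectrum, and then
      the trace support is all of it.\<close>
    then have "finite (spectrum D A)"
      using trace_power_0_finite_imp_finite_spectrum[OF assms(1,2), of \<phi>] fin
      by (simp add: not_less_eq_eq)
    then show ?thesis by (simp add: trace_power_def trace_support_def)
  qed
  have "primitive_form (spectral_form (spectrum D A) (alg_mult D A))
      (Poly_Mapping.single 1 1) (Poly_Mapping.single 0 1)
      ((multiplication_operator \<phi> ^^ n) (diagonal_vector D A \<phi>)) (diagonal_vector D A \<phi>) =
      (\<Sum>s\<in>trace_support D A \<phi>. real (alg_mult D A s) * Re (\<phi> s ^ n))"
    using keys_diagonal_vector[OF assms(3) \<phi>] K strip_excludes_endpoints[OF assms(3)]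
    by (subst primitive_spectral_form[of _ "trace_support D A \<phi>"])
      (auto simp: lookup_diagonal_vector[OF \<phi>] intro!: sum.cong)
  also have "\<dots> = Re (trace_power D A \<phi> n)"
    unfolding tr by (simp add: Re_sum)
  finally show "trace_power D A \<phi> n = complex_of_real
      (primitive_form (spectral_form (spectrum D A) (alg_mult D A))
        (Poly_Mapping.single 1 1) (Poly_Mapping.single 0 1)
        ((multiplication_operator \<phi> ^^ n) (diagonal_vector D A \<phi>)) (diagonal_vector D A \<phi>))"
    using trace_power_real[OF assms(4), of \<phi> n] \<phi>
    by (simp add: finite_spectral_support_def of_real_Re)
qed

section \<open>Growth conditions and assembly\<close>

lemma cutoff_function_finite_support:
  assumes "OP2 D A" "OP4 D A" "cutoff_function D A Y \<phi>"
  shows "\<phi> \<in> finite_spectral_support D A"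
proof -
  have "{s\<in>spectrum D A. \<phi> s \<noteq> 0} \<subseteq> spectrum_cutoff D A Y"
    using assms(3) by (auto simp: cutoff_function_def)
  then show ?thesis
    using finite_subset[OF _ finite_spectrum_cutoff[OF assms(1,2)]] assms(3)
    by (auto simp: finite_spectral_support_def cutoff_function_def)
qed

text \<open>The values of \<open>\<phi> Y\<close> at 0 and 1 give (d) and (e). The Riemann
  Hypothesis enters in (f): each nonzero \<open>\<phi> Y s\<close> on the spectrum has modulus
  \<open>sqrt q\<close>, so its \<open>n\<close>-th power has squared modulus
  \<open>q ^ n\<close>.\<close>

lemma INT1_spectral_form:
  fixes \<phi> :: "real \<Rightarrow> complex \<Rightarrow> complex"
  assumes "OP2 D A" "OP4 D A" "riemann_hypothesis D A"
    and cut: "\<And>Y. Y > 0 \<Longrightarrow> cutoff_function D A Y (\<phi> Y)"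
  shows "INT1 (spectral_form (spectrum D A) (alg_mult D A))
    (Poly_Mapping.single 1 1) (Poly_Mapping.single 0 1)
    (diagonal_vector D A) multiplication_operator \<phi>"
proof -
  note plane = spectral_form_plane[OF strip_excludes_endpoints[OF assms(2)]]
  let ?\<beta> = "spectral_form (spectrum D A) (alg_mult D A)"
  have orbit: "?\<beta> (x n) (Poly_Mapping.single 1 1) = 1"
      "(\<lambda>n. ?\<beta> (x n) (Poly_Mapping.single 0 1)) \<in> O(\<lambda>n. q ^ n)"
      "(\<lambda>n. ?\<beta> (x n) (x n)) \<in> O(\<lambda>n. q ^ n)"
    if "Y > 0"
      and x_def: "x = (\<lambda>n. (multiplication_operator (\<phi> Y) ^^ n) (diagonal_vector D A (\<phi> Y)))"
      and q_def: "q = Re (\<phi> Y 1)"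
    for Y n x q
  proof -
    note c = cut[OF \<open>Y > 0\<close>]
    obtain q' where q': "q' > 0" "\<phi> Y 1 = complex_of_real q'"
      "\<And>s. s \<in> spectrum_cutoff D A Y \<Longrightarrow> norm (\<phi> Y s) = q' powr Re s"
      using cutoff_function_cases[OF c] by metis
    have q: "q > 0" "\<phi> Y 1 = complex_of_real q"
      "\<And>s. s \<in> spectrum_cutoff D A Y \<Longrightarrow> norm (\<phi> Y s) = q powr Re s"
      using q' by (auto simp: q_def)
    have \<phi>: "\<phi> Y \<in> finite_spectral_support D A"
      using cutoff_function_finite_support[OF assms(1,2) c] .
    note K = trace_support_props[OF \<phi>] and lookup_v = lookup_diagonal_vector[OF \<phi>]
    have x0: "Poly_Mapping.lookup (x n) 0 = 1" for n
      using c by (simp add: x_def lookup_v cutoff_function_def)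
    have x1: "Poly_Mapping.lookup (x n) 1 = complex_of_real (q ^ n)" for n
      by (simp add: x_def lookup_v q(2))
    show "?\<beta> (x n) (Poly_Mapping.single 1 1) = 1"
      by (simp add: plane x0)
    show "(\<lambda>n. ?\<beta> (x n) (Poly_Mapping.single 0 1)) \<in> O(\<lambda>n. q ^ n)"
      by (simp add: plane x1)
    \<comment> \<open>The 2 comes from the hyperbolic plane, the sum from the spectral part.\<close>
    define M where "M = 2 + (\<Sum>s\<in>trace_support D A (\<phi> Y). real (alg_mult D A s))"
    have "norm (?\<beta> (x n) (x n)) \<le> M * norm (q ^ n)" if "n \<ge> 1" for n
    proof -
      let ?T = "\<Sum>s\<in>trace_support D A (\<phi> Y). real (alg_mult D A s) * (norm (\<phi> Y s ^ n))\<^sup>2"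
      have keys: "Poly_Mapping.keys (x n) \<inter> spectrum D A \<subseteq> trace_support D A (\<phi> Y)"
        using keys_diagonal_vector[OF assms(2) \<phi>] by (auto simp: x_def in_keys_iff)
      have "Re (Poly_Mapping.lookup (x n) s * cnj (Poly_Mapping.lookup (x n) s)) =
          (norm (\<phi> Y s ^ n))\<^sup>2" if "s \<in> trace_support D A (\<phi> Y)" for s
      proof -
        have "Poly_Mapping.lookup (x n) s = \<phi> Y s ^ n"
          using that by (simp add: x_def lookup_v)
        then show ?thesis
          by (simp only: complex_norm_square[symmetric] Re_complex_of_real)
      qed
      then have "(\<Sum>s\<in>trace_support D A (\<phi> Y). real (alg_mult D A s) *
          Re (Poly_Mapping.lookup (x n) s * cnj (Poly_Mapping.lookup (x n) s))) = ?T"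
        by (intro sum.cong refl) (simp only:)
      then have "?\<beta> (x n) (x n) = 2 * q ^ n - ?T"
        unfolding spectral_form_superset[OF K(1) disjI1[OF keys] K(2)] x0 x1 by simp
      moreover have "?T \<ge> 0"
        by (intro sum_nonneg) auto
      moreover have "?T \<le> (\<Sum>s\<in>trace_support D A (\<phi> Y). real (alg_mult D A s) * q ^ n)"
      proof (intro sum_mono mult_left_mono)
        fix s assume "s \<in> trace_support D A (\<phi> Y)"
        then have s: "s \<in> spectrum D A" using K(2) by auto
        show "(norm (\<phi> Y s ^ n))\<^sup>2 \<le> q ^ n"
        proof (cases "s \<in> spectrum_cutoff D A Y")
          case True
          moreover have "Re s = 1 / 2"
            using s assms(3) unfolding riemann_hypothesis_def by blast
          ultimately have "norm (\<phi> Y s) = sqrt q"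
            by (metis q(1,3) powr_half_sqrt less_imp_le)
          then show ?thesis
            using q(1) by (simp add: norm_power power_mult[symmetric] mult.commute[of n])
              (simp add: power_mult)
        next
          case False
          \<comment> \<open>This case arises only for finite spectrum, where the trace support
            includes zeros of \<open>\<phi> Y\<close>.\<close>
          then have "\<phi> Y s = 0"
            using c s by (auto simp: cutoff_function_def)
          then show ?thesis using \<open>n \<ge> 1\<close> q(1) by (simp add: power_0_left)
        qed
      qed auto
      moreover have "q ^ n > 0"
        using q(1) by simp
      ultimately show ?thesis
        by (simp add: M_def sum_distrib_right[symmetric] distrib_right abs_le_iff)
    qed
    then show "(\<lambda>n. ?\<beta> (x n) (x n)) \<in> O(\<lambda>n. q ^ n)"
      by (intro bigoI[of _ M]) (auto simp: eventually_sequentially)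
  qed
  have "\<forall>x y. ?\<beta> x y = ?\<beta> y x"
    by (simp add: spectral_form_commute[of "spectrum D A"])
  then show ?thesis
    unfolding INT1_def Let_def
    using orbit by (simp add: plane lookup_single)
qed

theorem riemann_hypothesis_imp_intersection_theory:
  fixes A :: "'h::complex_hilbert_space \<Rightarrow> 'h" and \<phi> :: "real \<Rightarrow> complex \<Rightarrow> complex"
  assumes "OP2 D A" "OP3 D A" "OP4 D A" "OP5 D A" "riemann_hypothesis D A"
    and "\<And>Y. Y > 0 \<Longrightarrow> cutoff_function D A Y (\<phi> Y)"
  shows "admits_intersection_theory TYPE(complex \<Rightarrow>\<^sub>0 complex) D A \<phi>"
proof -
  let ?v01 = "Poly_Mapping.single 1 1 :: complex \<Rightarrow>\<^sub>0 complex"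
  let ?v10 = "Poly_Mapping.single 0 1 :: complex \<Rightarrow>\<^sub>0 complex"
  have "Poly_Mapping.lookup ?v01 1 \<noteq> 0" "Poly_Mapping.lookup ?v10 0 \<noteq> 0"
      "Poly_Mapping.lookup (?v01 + ?v10) 1 \<noteq> 0"
    by (simp_all add: lookup_add lookup_single)
  then have ne: "?v01 \<noteq> 0" "?v10 \<noteq> 0" "?v01 + ?v10 \<noteq> 0"
    by (metis lookup_zero)+
  show ?thesis
    unfolding admits_intersection_theory_def
    using ne assms bilinear_spectral_form spectral_form_commute
      real_subalgebra_finite_spectral_support cutoff_function_finite_support
      real_algebra_hom_multiplication_operator INT1_spectral_form INT3_spectral_form
      INT2_spectral_form[OF strip_excludes_endpoints[OF assms(3)]]
    by (intro exI[of _ "spectral_form (spectrum D A) (alg_mult D A)"] exI[of _ ?v01]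
        exI[of _ ?v10] exI[of _ "?v01 + ?v10"] exI[of _ "finite_spectral_support D A"]
        exI[of _ "diagonal_vector D A"] exI[of _ multiplication_operator]) blast
qed

text \<open>The first conjunct fixes the space on which the theory is constructed; the second lets a
  theory on any real vector space imply the hypothesis.\<close>

theorem theorem3p5:
  fixes D :: "'h::complex_hilbert_space set" and A :: "'h \<Rightarrow> 'h"
    and \<phi> :: "real \<Rightarrow> complex \<Rightarrow> complex"
  assumes "separable_space (euclidean :: 'h topology)"
    and "linear_operator D A"
    and "OP1 D A" and "OP2 D A" and "OP3 D A" and "OP4 D A" and "OP5 D A"
    and "\<And>Y. Y > 0 \<Longrightarrow> cutoff_function D A Y (\<phi> Y)"
  shows "(riemann_hypothesis D A \<longleftrightarrow>
            admits_intersection_theory TYPE(complex \<Rightarrow>\<^sub>0 complex) D A \<phi>) \<and>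
         (admits_intersection_theory TYPE('v::real_vector) D A \<phi> \<longrightarrow> riemann_hypothesis D A)"
  using riemann_hypothesis_imp_intersection_theory[of D A \<phi>]
    intersection_theory_imp_riemann_hypothesis[of D A \<phi>, where ?'v = "complex \<Rightarrow>\<^sub>0 complex"]
    intersection_theory_imp_riemann_hypothesis[of D A \<phi>, where ?'v = 'v] assms
  by blast

end
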